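(* Let $\boldsymbol{x}$ be one of the receiver trajectories, and let $d_{\boldsymbol{x}}(t)=|\boldsymbol{x}(h_{\boldsymbol{x}}(t))-\boldsymbol{y}(t)|$ for $t\ge0$ and $d_{\boldsymbol{z}}(t)=|\boldsymbol{y}(t)-\boldsymbol{z}(h_{\boldsymbol{z}}^{-1}(t))|$ for $t\ge T_0$ be the associated distance functions. Let $U_{\boldsymbol{x}}(t)=u^{\mathrm{sc}}(\boldsymbol{x}(t),t)$ be the recorded scattered signal. Then $d_{\boldsymbol{x}}$ satisfies the ordinary differential equation $$ d_{\boldsymbol{x}}'(t)=\frac{\dfrac{c\,\varphi\bigl(t-d_{\boldsymbol{z}}(t)/c\bigr)}{4\pi\,d_{\boldsymbol{z}}(t)}+\bigl(c-4\pi c\alpha\,d_{\boldsymbol{x}}(t)\bigr)\,U_{\boldsymbol{x}}\!\left(\frac{d_{\boldsymbol{x}}(t)}{c}+t\right)}{U_{\boldsymbol{x}}\!\left(\frac{d_{\boldsymbol{x}}(t)}{c}+t\right)+\frac{d_{\boldsymbol{x}}(t)}{c}\,U_{\boldsymbol{x}}'\!\left(\frac{d_{\boldsymbol{x}}(t)}{c}+t\right)}-c,\qquad t\ge T_0. $$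
   Context: Standing setting. $c>0$ is the wave speed and $\alpha>0$ is the scattering parameter. The emitter has trajectory $\boldsymbol{z}$ and strength $\varphi\in C^1([0,\infty))$ with $\varphi(t)>0$ for all $t\ge0$; the scatterer has trajectory $\boldsymbol{y}$; four receivers have trajectories $\boldsymbol{x}_1,\dots,\boldsymbol{x}_4$, and $\boldsymbol{x}$ denotes any one of them. All trajectories are $C^1$ maps $[0,\infty)\to\mathbb{R}^3$ and there is $c_0\in(0,c)$ such that all their speeds are $<c_0$ for all $t>0$. There are smooth bounded domains $\Omega_1\subset\Omega_2$ with $\boldsymbol{y}(t)\in\Omega_1$ and $\boldsymbol{z}(t),\boldsymbol{x}_i(t)\in\mathbb{R}^3\setminus\overline{\Omega_2}$ for all $t\ge0$; the emitter and receiver trajectories do not intersect each other over $(0,T)$ for some sufficiently large $T>0$. For any $t_1,\dots,t_4>0$ the points $\boldsymbol{x}_1(t_1),\dots,\boldsymbol{x}_4(t_4)$ are not coplanar. Fields ($H$ is the Heaviside function). The incident field is $$u^{\mathrm{in}}(\mathbf{p},t)=\frac{H(t-|\mathbf{p}-\boldsymbol{z}(0)|/c)}{4\pi|\mathbf{p}-\boldsymbol{z}(\tau_1)|}\varphi(\tau_1),\qquad t-\tau_1-|\mathbf{p}-\boldsymbol{z}(\tau_1)|/c=0,$$ the intensity $q$ solves $q'(t)+4\pi c\alpha q(t)=4\pi c\,u^{\mathrm{in}}(\boldsymbol{y}(t),t)$, $q(0)=0$, i.e. $q(t)=4\pi c\int_0^te^{-4\pi c\alpha(t-s)}u^{\mathrm{in}}(\boldsymbol{y}(s),s)\,ds$,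 and the scattered field is $$u^{\mathrm{sc}}(\mathbf{p},t)=\frac{H(t-|\mathbf{p}-\boldsymbol{y}(0)|/c)}{4\pi|\mathbf{p}-\boldsymbol{y}(\tau_2)|}q(\tau_2),\qquad t-\tau_2-|\mathbf{p}-\boldsymbol{y}(\tau_2)|/c=0.$$ Travel-time functions. On $[0,\infty)\times[0,\infty)$ let $g_{\boldsymbol{z}}(t,s)=t-s-|\boldsymbol{y}(t)-\boldsymbol{z}(s)|/c$ and $g_{\boldsymbol{x}}(t,s)=t-s-|\boldsymbol{x}(t)-\boldsymbol{y}(s)|/c$. $T_0>0$ is the time with $g_{\boldsymbol{z}}(T_0,0)=0$. $h_{\boldsymbol{z}},h_{\boldsymbol{x}}$ are the unique strictly increasing $C^1$ functions on $[0,\infty)$ with $g_{\boldsymbol{z}}(h_{\boldsymbol{z}}(s),s)=0$ and $g_{\boldsymbol{x}}(h_{\boldsymbol{x}}(s),s)=0$ for all $s\ge0$; in particular $h_{\boldsymbol{z}}(0)=T_0$ and $h_{\boldsymbol{z}}^{-1}:[T_0,\infty)\to[0,\infty)$ is well defined. At $t=T_0$, derivatives in $t$ on $[T_0,\infty)$ and the derivative $U_{\boldsymbol{x}}'$ at the arrival time $h_{\boldsymbol{x}}(T_0)$ are understood as right derivatives.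
   Formalization: The denominator of the ODE can vanish in this setting, leaving the quotient 0/0; the formal statement asserts the ODE at every t ≥ T_0 where the denominator is nonzero and, where it vanishes, that the numerator vanishes too. *)

theory Defs
  imports "HOL-Analysis.Analysis"
begin

type_synonym trajectory = "real \<Rightarrow> real^3"

(* C^1 on [0,oo), with the one-sided derivative at 0; the library's C1_differentiable_on
   would require a two-sided derivative at 0. *)
definition C1_halfline :: "(real \<Rightarrow> 'a::real_normed_vector) \<Rightarrow> bool" where
  "C1_halfline f \<longleftrightarrow>
     (\<exists>f'. (\<forall>t\<ge>0. (f has_vector_derivative f' t) (at t within {0..})) \<and> continuous_on {0..} f')"

primrec Ck_on :: "nat \<Rightarrow> 'a::real_normed_vector set \<Rightarrow> ('a \<Rightarrow> real) \<Rightarrow> bool" where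
  "Ck_on 0 W f \<longleftrightarrow> continuous_on W f"
| "Ck_on (Suc k) W f \<longleftrightarrow>
     (\<exists>f'. (\<forall>p\<in>W. (f has_derivative f' p) (at p)) \<and> (\<forall>v. Ck_on k W (\<lambda>p. f' p v)))"

definition smooth_on :: "'a::real_normed_vector set \<Rightarrow> ('a \<Rightarrow> real) \<Rightarrow> bool" where
  "smooth_on W f \<longleftrightarrow> (\<forall>k. Ck_on k W f)"

(* Smoothness of the boundary is expressed by local defining functions with nonvanishing
   derivative; the domain lies locally on the negative side. *)
definition smooth_bounded_domain :: "'a::real_normed_vector set \<Rightarrow> bool" where
  "smooth_bounded_domain \<Omega> \<longleftrightarrow>
     open \<Omega> \<and> connected \<Omega> \<and> \<Omega> \<noteq> {} \<and> bounded \<Omega> \<and>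
     (\<forall>p\<in>frontier \<Omega>. \<exists>W \<rho>. open W \<and> p \<in> W \<and> smooth_on W \<rho> \<and>
        (\<forall>q\<in>W. \<not> (\<rho> has_derivative (\<lambda>_. 0)) (at q)) \<and>
        \<Omega> \<inter> W = {q\<in>W. \<rho> q < 0})"

(* The value at 0 has no influence on the signal recorded by a receiver: the intensity q
   depends on the incident field only through an integral, and q(0) = 0. *)
definition heaviside :: "real \<Rightarrow> real" where
  "heaviside r = (if r < 0 then 0 else 1)"

(* tau with t - tau - |p - w(tau)|/c = 0. For a source slower than c it exists, uniquely in
   [0,oo), exactly when t >= |p - w(0)|/c, that is, where the Heaviside factor of the field is 1. *)
definition emission_time :: "real \<Rightarrow> trajectory \<Rightarrow> real^3 \<Rightarrow> real \<Rightarrow> real" where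
  "emission_time c w p t = (THE \<tau>. \<tau> \<ge> 0 \<and> t - \<tau> - norm (p - w \<tau>) / c = 0)"

definition point_source_field ::
    "real \<Rightarrow> trajectory \<Rightarrow> (real \<Rightarrow> real) \<Rightarrow> real^3 \<Rightarrow> real \<Rightarrow> real" where
  "point_source_field c w f p t =
     (let \<tau> = emission_time c w p t in
        heaviside (t - norm (p - w 0) / c) / (4 * pi * norm (p - w \<tau>)) * f \<tau>)"

definition u_in :: "real \<Rightarrow> trajectory \<Rightarrow> (real \<Rightarrow> real) \<Rightarrow> real^3 \<Rightarrow> real \<Rightarrow> real" where
  "u_in c z \<phi> = point_source_field c z \<phi>"

definition intensity ::
    "real \<Rightarrow> real \<Rightarrow> trajectory \<Rightarrow> trajectory \<Rightarrow> (real \<Rightarrow> real) \<Rightarrow> real \<Rightarrow> real" where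
  "intensity c \<alpha> y z \<phi> t =
     4 * pi * c *
     integral {0..t} (\<lambda>s. exp (- (4 * pi * c * \<alpha> * (t - s))) * u_in c z \<phi> (y s) s)"

definition u_sc ::
    "real \<Rightarrow> real \<Rightarrow> trajectory \<Rightarrow> trajectory \<Rightarrow> (real \<Rightarrow> real) \<Rightarrow> real^3 \<Rightarrow> real \<Rightarrow> real" where
  "u_sc c \<alpha> y z \<phi> = point_source_field c y (intensity c \<alpha> y z \<phi>)"

(* g c a b t s: sent from b at time s, received by a at time t.
   Thus g_z is g c y z and g_x is g c x y. *)
definition g :: "real \<Rightarrow> trajectory \<Rightarrow> trajectory \<Rightarrow> real \<Rightarrow> real \<Rightarrow> real" where
  "g c a b t s = t - s - norm (a t - b s) / c"

(* The extensional function space makes the function on [0,oo) unique as a HOL function. *)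
definition arrival_time :: "real \<Rightarrow> trajectory \<Rightarrow> trajectory \<Rightarrow> real \<Rightarrow> real" where
  "arrival_time c a b =
     (THE h. h \<in> {0..} \<rightarrow>\<^sub>E {0..} \<and> strict_mono_on {0..} h \<and> C1_halfline h \<and>
             (\<forall>s\<ge>0. g c a b (h s) s = 0))"

definition first_arrival :: "real \<Rightarrow> trajectory \<Rightarrow> trajectory \<Rightarrow> real" where
  "first_arrival c a b = (THE t. t > 0 \<and> g c a b t 0 = 0)"

end

theory Submission
  imports Defs
begin

text \<open>
  Write \<open>h\<close> for the arrival time at the receiver of a signal that the scatterer emits at time
  \<open>s\<close>, so that \<open>h(s) = s + d(s) / c\<close>, where \<open>d\<close> is the distance of \<open>x(h(s))\<close> from \<open>y(s)\<close>.
  Along the receiver the retarded field is explicit: \<open>U(h(s)) = q(s) / (4 \<pi> d(s))\<close>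
  (lemma \<open>field_at_receiver\<close>).  Differentiating \<open>q = 4 \<pi> d U(h)\<close> in \<open>s\<close>, with \<open>h' = 1 + d'/c\<close>,
  and adding \<open>c q / d = 4 \<pi> c U(h)\<close> gives
    \<open>q' + c q / d = 4 \<pi> (c + d') (U(h) + (d/c) U'(h))\<close>,
  which is linear in the unknown \<open>d'\<close>.  The equation for the intensity replaces
  \<open>q'\<close> by \<open>4 \<pi> c (u_in - \<alpha> q)\<close>, and \<open>q = 4 \<pi> d U\<close> turns the left-hand side into
  \<open>4 \<pi>\<close> times the numerator of the claimed formula (lemma \<open>distance_equation_algebra\<close>).  Since \<open>c + d' = c h'\<close>
  is positive, numerator and denominator vanish only together.

  The analytic work is the differentiability of \<open>h\<close> with \<open>h' > 0\<close> (\<open>arrival_deriv\<close>,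
  \<open>doppler_pos\<close>), that of its inverse, the emission time (\<open>emission_deriv\<close>), and the equation
  for \<open>q\<close> (\<open>intensity_deriv\<close>).  All three rest on the speed bound \<open>c0 < c\<close>: it makes the
  travel-time function strictly monotone in each variable with slopes bounded away from zero.
  The pair emitter-scatterer and the pair scatterer-receiver have the same geometry, so
  this theory is developed once, for an abstract receiver and an abstract source that stay apart.
\<close>

section \<open>Subsonic curves\<close>

text \<open>The speed is bounded only at positive times; the bound passes to the one-sided derivative
  at 0, as a weak inequality, by continuity.\<close>

lemma subsonic_derivative:
  assumes f: "C1_halfline f" and speed: "\<forall>t>0. norm (vector_derivative f (at t)) < c0"
  obtains f' where "\<And>t. t \<ge> 0 \<Longrightarrow> (f has_vector_derivative f' t) (at t within {0..})"
    and "continuous_on {0..} f'" and "\<And>t. t \<ge> 0 \<Longrightarrow> norm (f' t) \<le> c0"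
proof -
  obtain f' where "\<forall>t\<ge>0. (f has_vector_derivative f' t) (at t within {0..})"
    and cont: "continuous_on {0..} f'"
    using f unfolding C1_halfline_def by (elim exE conjE)
  then have f': "\<And>t. t \<ge> 0 \<Longrightarrow> (f has_vector_derivative f' t) (at t within {0..})"
    by simp
  have pos: "norm (f' t) < c0" if "t > 0" for t
  proof -
    have "at t within {0..} = at t"
      by (rule at_within_interior) (use that in simp)
    then have "vector_derivative f (at t) = f' t"
      using f'[of t] that by (simp add: vector_derivative_at)
    then show ?thesis
      using speed[rule_format, OF that] by simp
  qed
  have "norm (f' 0) \<le> c0"
  proof (rule tendsto_upperbound[where F = "at_right 0"])
    show "((\<lambda>t. norm (f' t)) \<longlongrightarrow> norm (f' 0)) (at_right 0)"
    proof (rule tendsto_norm)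
      have "(f' \<longlongrightarrow> f' 0) (at 0 within {0..})"
        using cont by (simp add: continuous_on_def)
      then show "(f' \<longlongrightarrow> f' 0) (at_right 0)"
        by (rule tendsto_within_subset) auto
    qed
    show "\<forall>\<^sub>F t in at_right 0. norm (f' t) \<le> c0"
      unfolding eventually_at_filter using pos by (intro always_eventually) (simp add: less_imp_le)
  qed simp
  then have "norm (f' t) \<le> c0" if "t \<ge> 0" for t
    using pos[of t] that by (cases "t = 0") (simp_all add: less_imp_le)
  with f' cont show ?thesis
    by (rule that)
qed

lemma lipschitz_halfline:
  fixes f :: "real \<Rightarrow> 'a::real_normed_vector"
  assumes f': "\<And>t. t \<ge> 0 \<Longrightarrow> (f has_vector_derivative f' t) (at t within {0..})"
    and bound: "\<And>t. t \<ge> 0 \<Longrightarrow> norm (f' t) \<le> M" and "s \<ge> 0" "t \<ge> 0"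
  shows "norm (f t - f s) \<le> M * \<bar>t - s\<bar>"
proof -
  have "norm (f t - f s) \<le> M * norm (t - s)"
  proof (rule differentiable_bound[where S = "{0..}" and f' = "\<lambda>t h. h *\<^sub>R f' t"])
    fix r :: real assume "r \<in> {0..}"
    then show "(f has_derivative (\<lambda>h. h *\<^sub>R f' r)) (at r within {0..})"
      using f'[of r] by (simp add: has_vector_derivative_def)
    show "onorm (\<lambda>h. h *\<^sub>R f' r) \<le> M"
    proof (rule onorm_le)
      show "norm (h *\<^sub>R f' r) \<le> M * norm h" for h :: real
        using mult_right_mono[OF bound[of r], of "norm h"] \<open>r \<in> {0..}\<close> by (simp add: mult.commute)
    qed
  qed (use \<open>s \<ge> 0\<close> \<open>t \<ge> 0\<close> in auto)
  then show ?thesis by simp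
qed

text \<open>Caratheodory's form of the derivative: it replaces error terms by exact identities, which
  can be solved for a quotient before any limit is taken.\<close>

lemma difference_quotient:
  fixes f :: "real \<Rightarrow> 'a::real_normed_vector"
  assumes f': "(f has_vector_derivative D) (at r within S)"
  obtains Q where "\<And>t. f t - f r = (t - r) *\<^sub>R Q t" and "continuous (at r within S) Q"
    and "Q r = D"
proof
  let ?Q = "\<lambda>t. if t = r then D else (f t - f r) /\<^sub>R (t - r)"
  show "f t - f r = (t - r) *\<^sub>R ?Q t" for t
    by simp
  have "((\<lambda>t. norm (f t - f r - (t - r) *\<^sub>R D) / norm (t - r)) \<longlongrightarrow> 0) (at r within S)"
    using f' by (simp add: has_vector_derivative_def has_derivative_iff_norm)
  then have "((\<lambda>t. norm ((f t - f r) /\<^sub>R (t - r) - D)) \<longlongrightarrow> 0) (at r within S)"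
  proof (rule Lim_transform_within[where d = 1])
    fix t assume "0 < dist t r"
    then have "(f t - f r) /\<^sub>R (t - r) - D = (f t - f r - (t - r) *\<^sub>R D) /\<^sub>R (t - r)"
      by (simp add: scaleR_diff_right)
    then show "norm (f t - f r - (t - r) *\<^sub>R D) / norm (t - r)
        = norm ((f t - f r) /\<^sub>R (t - r) - D)"
      by (simp add: divide_inverse mult.commute)
  qed simp
  then have "((\<lambda>t. (f t - f r) /\<^sub>R (t - r)) \<longlongrightarrow> D) (at r within S)"
    by (simp add: tendsto_norm_zero_iff Lim_null[of _ D])
  then have "(?Q \<longlongrightarrow> D) (at r within S)"
    by (rule Lim_transform_within[where d = 1]) auto
  then show "continuous (at r within S) ?Q"
    by (simp add: continuous_within)
  show "?Q r = D"
    by simp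
qed

text \<open>An exact first-order expansion of the norm.  By the triangle inequality the vector multiplying
  \<open>v - w\<close> has norm at most 1, and as \<open>v\<close> tends to \<open>w\<close> it tends to the unit vector of \<open>w\<close>,
  the gradient of the norm.\<close>

lemma norm_diff_eq_inner:
  fixes v w :: "'a::real_inner"
  assumes "w \<noteq> 0"
  shows "norm v - norm w = ((v + w) /\<^sub>R (norm v + norm w)) \<bullet> (v - w)"
proof -
  have pos: "norm v + norm w > 0"
    using assms by (simp add: add_nonneg_pos)
  have "(v + w) \<bullet> (v - w) = (norm v - norm w) * (norm v + norm w)"
    by (simp add: inner_diff_right inner_add_left inner_commute norm_eq_sqrt_inner algebra_simps)
  then have "((v + w) /\<^sub>R (norm v + norm w)) \<bullet> (v - w)
      = inverse (norm v + norm w) * ((norm v - norm w) * (norm v + norm w))"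
    by simp
  then show ?thesis
    using pos by simp
qed

text \<open>A one-sided form of the inverse rule: \<open>R\<close> need not be a neighbourhood of \<open>r\<close>, as is
  needed at the first arrival.\<close>

lemma has_real_derivative_inverse_within:
  fixes f k :: "real \<Rightarrow> real"
  assumes f: "(f has_real_derivative D) (at (k r) within S)" and "D \<noteq> 0"
    and k: "continuous (at r within R) k" and "r \<in> R"
    and inv: "\<And>t. t \<in> R \<Longrightarrow> k t \<in> S \<and> f (k t) = t"
  shows "(k has_real_derivative 1 / D) (at r within R)"
proof -
  have "filterlim k (at (k r) within S) (at r within R)"
    unfolding filterlim_at
  proof
    show "\<forall>\<^sub>F t in at r within R. k t \<in> S \<and> k t \<noteq> k r"
      unfolding eventually_at_filter
    proof (rule always_eventually, intro allI impI)
      fix t assume "t \<noteq> r" "t \<in> R"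
      then show "k t \<in> S \<and> k t \<noteq> k r"
        using inv[of t] inv[OF \<open>r \<in> R\<close>] by auto
    qed
    show "(k \<longlongrightarrow> k r) (at r within R)"
      using k by (simp add: continuous_within)
  qed
  with f have "((\<lambda>t. (f (k t) - f (k r)) / (k t - k r)) \<longlongrightarrow> D) (at r within R)"
    unfolding has_field_derivative_iff by (rule filterlim_compose)
  then have "((\<lambda>t. inverse ((f (k t) - f (k r)) / (k t - k r))) \<longlongrightarrow> inverse D) (at r within R)"
    using \<open>D \<noteq> 0\<close> by (rule tendsto_inverse)
  then show ?thesis
    unfolding has_field_derivative_iff inverse_eq_divide[of D]
    by (rule Lim_transform_within[where d = 1]) (use inv \<open>r \<in> R\<close> in \<open>auto simp: inverse_eq_divide\<close>)
qed

section \<open>Signals between two subsonic points\<close>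

text \<open>The source \<open>b\<close> emits, the receiver \<open>a\<close> records.  The bound \<open>c0\<close> on the speeds lies strictly
  below the wave speed, and the two curves stay apart at all pairs of times, so that the distance
  a signal travels never vanishes and the norm is differentiable there.\<close>

locale signal_path =
  fixes c c0 :: real and a b a' b' :: trajectory
  assumes c0_nonneg: "0 \<le> c0" and c0_less: "c0 < c"
    and a_deriv: "\<And>t. t \<ge> 0 \<Longrightarrow> (a has_vector_derivative a' t) (at t within {0..})"
    and b_deriv: "\<And>t. t \<ge> 0 \<Longrightarrow> (b has_vector_derivative b' t) (at t within {0..})"
    and a'_cont: "continuous_on {0..} a'" and b'_cont: "continuous_on {0..} b'"
    and a'_le: "\<And>t. t \<ge> 0 \<Longrightarrow> norm (a' t) \<le> c0"
    and b'_le: "\<And>t. t \<ge> 0 \<Longrightarrow> norm (b' t) \<le> c0"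
    and apart: "\<And>t s. t \<ge> 0 \<Longrightarrow> s \<ge> 0 \<Longrightarrow> a t \<noteq> b s"
begin

abbreviation gap :: "real \<Rightarrow> real \<Rightarrow> real" where
  "gap \<equiv> g c a b"

lemma c_pos: "c > 0"
  using c0_nonneg c0_less by simp

lemma a_lipschitz: "s \<ge> 0 \<Longrightarrow> t \<ge> 0 \<Longrightarrow> norm (a t - a s) \<le> c0 * \<bar>t - s\<bar>"
  using lipschitz_halfline[OF a_deriv a'_le] .

lemma b_lipschitz: "s \<ge> 0 \<Longrightarrow> t \<ge> 0 \<Longrightarrow> norm (b t - b s) \<le> c0 * \<bar>t - s\<bar>"
  using lipschitz_halfline[OF b_deriv b'_le] .

lemma a_cont: "continuous_on {0..} a"
  using a_deriv by (auto simp: continuous_on_eq_continuous_within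
      intro: has_vector_derivative_continuous)

lemma b_cont: "continuous_on {0..} b"
  using b_deriv by (auto simp: continuous_on_eq_continuous_within
      intro: has_vector_derivative_continuous)

lemma c_times_gap: "c * gap t s = c * (t - s) - norm (a t - b s)"
  using c_pos by (simp add: g_def right_diff_distrib)

lemma gap_zero_iff: "gap t s = 0 \<longleftrightarrow> norm (a t - b s) = c * (t - s)"
  using c_times_gap[of t s] c_pos by auto

lemma gap_receiver_mono:
  assumes "0 \<le> t1" "t1 \<le> t2"
  shows "(c - c0) * (t2 - t1) \<le> c * (gap t2 s - gap t1 s)"
proof -
  have "norm (a t2 - b s) \<le> norm (a t1 - b s) + norm (a t2 - a t1)"
    using norm_triangle_ineq[of "a t1 - b s" "a t2 - a t1"] by simp
  also have "\<dots> \<le> norm (a t1 - b s) + c0 * (t2 - t1)"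
    using a_lipschitz[of t1 t2] assms by simp
  finally show ?thesis
    by (simp add: right_diff_distrib[of c "gap _ _"] c_times_gap algebra_simps)
qed

lemma gap_source_antimono:
  assumes "0 \<le> s1" "s1 \<le> s2"
  shows "(c - c0) * (s2 - s1) \<le> c * (gap t s1 - gap t s2)"
proof -
  have "norm (a t - b s1) \<le> norm (a t - b s2) + norm (b s2 - b s1)"
    using norm_triangle_ineq[of "a t - b s2" "b s2 - b s1"] by simp
  also have "\<dots> \<le> norm (a t - b s2) + c0 * (s2 - s1)"
    using b_lipschitz[of s1 s2] assms by simp
  finally show ?thesis
    by (simp add: right_diff_distrib[of c "gap _ _"] c_times_gap algebra_simps)
qed

lemma gap_receiver_strict: "0 \<le> t1 \<Longrightarrow> t1 < t2 \<Longrightarrow> gap t1 s < gap t2 s"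
  using gap_receiver_mono[of t1 t2 s] mult_pos_pos[of "c - c0" "t2 - t1"] c0_less c_pos
    zero_less_mult_pos[of c "gap t2 s - gap t1 s"] by linarith

lemma gap_source_strict: "0 \<le> s1 \<Longrightarrow> s1 < s2 \<Longrightarrow> gap t s2 < gap t s1"
  using gap_source_antimono[of s1 s2 t] mult_pos_pos[of "c - c0" "s2 - s1"] c0_less c_pos
    zero_less_mult_pos[of c "gap t s1 - gap t s2"] by linarith

lemma gap_diag: "gap s s \<le> 0"
  using c_pos by (simp add: g_def)

text \<open>The travel-time function is nonpositive at the moment of emission, and it grows at a
  rate of at least \<open>1 - c0/c\<close> in the receiving time, so it has exactly one zero.\<close>

lemma ex1_arrival:
  assumes "s \<ge> 0"
  shows "\<exists>!t. t \<ge> 0 \<and> gap t s = 0"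
proof -
  \<comment> \<open>By time \<open>r\<close> the signal has caught up even with a receiver that flees at speed \<open>c0\<close>.\<close>
  define r where "r = s + norm (a s - b s) / (c - c0)"
  have "s \<le> r"
    using c0_less by (simp add: r_def)
  have "norm (a s - b s) \<le> c * (gap r s - gap s s)"
    using gap_receiver_mono[of s r s] assms \<open>s \<le> r\<close> c0_less by (simp add: r_def)
  also have "\<dots> = c * gap r s + norm (a s - b s)"
    by (simp add: right_diff_distrib[of c "gap _ _"] c_times_gap)
  finally have "0 \<le> gap r s"
    using c_pos by (simp add: zero_le_mult_iff)
  moreover have "continuous_on {s..r} (\<lambda>t. gap t s)"
    unfolding g_def
    by (intro continuous_intros continuous_on_subset[OF a_cont]) (use c_pos assms in auto)
  ultimately obtain t where "s \<le> t" "gap t s = 0"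
    using IVT'[of "\<lambda>t. gap t s" s 0 r] gap_diag \<open>s \<le> r\<close> by auto
  then show ?thesis
    using assms gap_receiver_strict by (metis linorder_cases order_less_irrefl order_trans)
qed

definition arrival :: "real \<Rightarrow> real" where
  "arrival s = (THE t. t \<ge> 0 \<and> gap t s = 0)"

lemma arrival: "s \<ge> 0 \<Longrightarrow> arrival s \<ge> 0" "s \<ge> 0 \<Longrightarrow> gap (arrival s) s = 0"
  using theI'[OF ex1_arrival] unfolding arrival_def by auto

lemma arrival_eqI: "s \<ge> 0 \<Longrightarrow> t \<ge> 0 \<Longrightarrow> gap t s = 0 \<Longrightarrow> arrival s = t"
  using ex1_arrival[of s] arrival[of s] by blast

lemma distance_at_arrival: "s \<ge> 0 \<Longrightarrow> norm (a (arrival s) - b s) = c * (arrival s - s)"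
  using arrival gap_zero_iff by blast

lemma arrival_later: "s \<ge> 0 \<Longrightarrow> s < arrival s"
  using distance_at_arrival[of s] apart[OF arrival(1), of s s] c_pos
  by (metis diff_gt_0_iff_gt right_minus_eq zero_less_mult_pos zero_less_norm_iff)

lemma arrival_strict_mono: "0 \<le> s1 \<Longrightarrow> s1 < s2 \<Longrightarrow> arrival s1 < arrival s2"
  using gap_source_strict[of s1 s2 "arrival s2"] arrival[of s1] arrival[of s2]
    gap_receiver_strict[of "arrival s2" "arrival s1" s1]
  by (smt (verit))

lemma arrival_mono: "0 \<le> s1 \<Longrightarrow> s1 \<le> s2 \<Longrightarrow> arrival s1 \<le> arrival s2"
  using arrival_strict_mono[of s1 s2] by (cases "s1 = s2") auto

text \<open>Between two signals the travelled distance \<open>c (arrival s - s)\<close> changes by at most the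
  displacements of the two curves.  Since \<open>c0 < c\<close>, this bounds the increments of emission and
  arrival times by each other, in both directions.\<close>

lemma arrival_increment_bound:
  assumes "s1 \<ge> 0" "s2 \<ge> 0"
  shows "\<bar>c * (arrival s2 - arrival s1) - c * (s2 - s1)\<bar>
     \<le> c0 * \<bar>arrival s2 - arrival s1\<bar> + c0 * \<bar>s2 - s1\<bar>"
proof -
  have "\<bar>c * (arrival s2 - arrival s1) - c * (s2 - s1)\<bar>
      = \<bar>norm (a (arrival s2) - b s2) - norm (a (arrival s1) - b s1)\<bar>"
    using assms by (simp add: distance_at_arrival algebra_simps)
  also have "\<dots> \<le> norm ((a (arrival s2) - a (arrival s1)) - (b s2 - b s1))"
    using norm_triangle_ineq3[of "a (arrival s2) - b s2" "a (arrival s1) - b s1"]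
    by (simp add: algebra_simps)
  also have "\<dots> \<le> norm (a (arrival s2) - a (arrival s1)) + norm (b s2 - b s1)"
    by (rule norm_triangle_ineq4)
  also have "\<dots> \<le> c0 * \<bar>arrival s2 - arrival s1\<bar> + c0 * \<bar>s2 - s1\<bar>"
    using assms arrival(1) by (intro add_mono a_lipschitz b_lipschitz)
  finally show ?thesis .
qed

lemma arrival_lipschitz:
  assumes "s1 \<ge> 0" "s2 \<ge> 0"
  shows "\<bar>arrival s2 - arrival s1\<bar> \<le> (c + c0) / (c - c0) * \<bar>s2 - s1\<bar>"
proof -
  have "\<bar>c * (arrival s2 - arrival s1)\<bar> \<le> \<bar>c * (s2 - s1)\<bar>
      + (c0 * \<bar>arrival s2 - arrival s1\<bar> + c0 * \<bar>s2 - s1\<bar>)"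
    using arrival_increment_bound[OF assms] by linarith
  then have "c * \<bar>arrival s2 - arrival s1\<bar> \<le> c * \<bar>s2 - s1\<bar>
      + (c0 * \<bar>arrival s2 - arrival s1\<bar> + c0 * \<bar>s2 - s1\<bar>)"
    using c_pos by (simp add: abs_mult)
  then show ?thesis
    using c0_less by (simp add: field_simps)
qed

lemma arrival_expansive:
  assumes "s1 \<ge> 0" "s2 \<ge> 0"
  shows "\<bar>s2 - s1\<bar> \<le> (c + c0) / (c - c0) * \<bar>arrival s2 - arrival s1\<bar>"
proof -
  have "\<bar>c * (s2 - s1)\<bar> \<le> \<bar>c * (arrival s2 - arrival s1)\<bar>
      + (c0 * \<bar>arrival s2 - arrival s1\<bar> + c0 * \<bar>s2 - s1\<bar>)"
    using arrival_increment_bound[OF assms] by linarith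
  then have "c * \<bar>s2 - s1\<bar> \<le> c * \<bar>arrival s2 - arrival s1\<bar>
      + (c0 * \<bar>arrival s2 - arrival s1\<bar> + c0 * \<bar>s2 - s1\<bar>)"
    using c_pos by (simp add: abs_mult)
  then show ?thesis
    using c0_less by (simp add: field_simps)
qed

lemma arrival_cont: "continuous_on {0..} arrival"
proof (rule lipschitz_on_continuous_on)
  show "((c + c0) / (c - c0))-lipschitz_on {0..} arrival"
    using arrival_lipschitz c0_less c0_nonneg by (intro lipschitz_onI) (auto simp: dist_real_def)
qed

text \<open>The direction of the ray from the source to the receiver.\<close>

definition direction :: "real \<Rightarrow> real^3" where
  "direction s = sgn (a (arrival s) - b s)"

text \<open>The Doppler factor: the duration of reception per duration of emission, which is the
  derivative of the arrival time.\<close>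

definition doppler :: "real \<Rightarrow> real" where
  "doppler s = (c - direction s \<bullet> b' s) / (c - direction s \<bullet> a' (arrival s))"

lemma inner_less_c:
  assumes "norm n \<le> 1" "norm v \<le> c0"
  shows "n \<bullet> v < c"
proof -
  have "n \<bullet> v \<le> norm n * norm v"
    by (rule norm_cauchy_schwarz)
  also have "\<dots> \<le> 1 * c0"
    using assms by (intro mult_mono) auto
  finally show ?thesis
    using c0_less by simp
qed

lemma doppler_denominators:
  assumes "s \<ge> 0"
  shows "direction s \<bullet> b' s < c" "direction s \<bullet> a' (arrival s) < c"
  using assms by (auto intro!: inner_less_c a'_le b'_le arrival simp: direction_def norm_sgn)

lemma doppler_pos: "s \<ge> 0 \<Longrightarrow> doppler s > 0"
  using doppler_denominators by (simp add: doppler_def)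

lemma doppler_cont: "continuous_on {0..} doppler"
proof -
  have a_arrival: "continuous_on {0..} (\<lambda>s. a (arrival s))"
    "continuous_on {0..} (\<lambda>s. a' (arrival s))"
    using arrival(1)
    by (auto intro!: continuous_on_compose2[OF a_cont arrival_cont]
        continuous_on_compose2[OF a'_cont arrival_cont])
  have "continuous_on {0..} direction"
    unfolding direction_def
    by (intro continuous_intros a_arrival b_cont) (use apart arrival in auto)
  then show ?thesis
    unfolding doppler_def
    by (intro continuous_intros a_arrival b'_cont) (use doppler_denominators in force)+
qed

text \<open>The travelled distance equals both
  \<open>c (arrival r - r)\<close> and the norm of the separation; expanding the norm exactly and the two
  curves in Caratheodory form, the increment of \<open>arrival\<close> enters linearly, with a coefficient
  that is positive because the curves are subsonic.  Solving for the difference quotient gives a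
  Doppler-like expression whose limit is the Doppler factor.\<close>

lemma arrival_deriv:
  assumes s: "s \<ge> 0"
  shows "(arrival has_real_derivative doppler s) (at s within {0..})"
proof -
  let ?h = arrival
  let ?v = "\<lambda>r. a (?h r) - b r"
  define n where "n r = (?v r + ?v s) /\<^sub>R (norm (?v r) + norm (?v s))" for r
  obtain A where A: "\<And>t. a t - a (?h s) = (t - ?h s) *\<^sub>R A t"
    and A_cont: "continuous (at (?h s) within {0..}) A" and A_s: "A (?h s) = a' (?h s)"
    using difference_quotient[OF a_deriv[OF arrival(1)[OF s]]] by blast
  obtain B where B: "\<And>t. b t - b s = (t - s) *\<^sub>R B t"
    and B_cont: "continuous (at s within {0..}) B" and B_s: "B s = b' s"
    using difference_quotient[OF b_deriv[OF s]] by blast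
  have v_s: "?v s \<noteq> 0"
    using apart arrival(1) s by simp
  have n_le: "norm (n r) \<le> 1" for r
  proof -
    have "norm (?v r) + norm (?v s) > 0"
      using v_s by (simp add: add_nonneg_pos)
    then show ?thesis
      using norm_triangle_ineq[of "?v r" "?v s"] by (simp add: n_def divide_simps)
  qed
  have A_le: "norm (A t) \<le> c0" if "t \<ge> 0" "t \<noteq> ?h s" for t
    using a_lipschitz[of "?h s" t] that arrival(1)[OF s] by (simp add: A mult.commute)
  have quotient: "(?h r - ?h s) / (r - s) = (c - n r \<bullet> B r) / (c - n r \<bullet> A (?h r))"
    if r: "r \<ge> 0" "r \<noteq> s" for r
  proof -
    have "?v r - ?v s = (?h r - ?h s) *\<^sub>R A (?h r) - (r - s) *\<^sub>R B r"
      using A[of "?h r"] B[of r] by (simp add: algebra_simps)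
    moreover have "c * (?h r - ?h s) - c * (r - s) = norm (?v r) - norm (?v s)"
      using r s by (simp add: distance_at_arrival algebra_simps)
    ultimately have "c * (?h r - ?h s) - c * (r - s)
        = n r \<bullet> ((?h r - ?h s) *\<^sub>R A (?h r) - (r - s) *\<^sub>R B r)"
      using norm_diff_eq_inner[OF v_s, of "?v r"] unfolding n_def by simp
    then have "(?h r - ?h s) * (c - n r \<bullet> A (?h r)) = (r - s) * (c - n r \<bullet> B r)"
      by (simp add: inner_diff_right algebra_simps)
    moreover have "?h r \<noteq> ?h s"
      using arrival_strict_mono[of r s] arrival_strict_mono[of s r] r s by linarith
    then have "n r \<bullet> A (?h r) < c"
      using arrival(1)[of r] r n_le A_le by (intro inner_less_c) auto
    ultimately show ?thesis
      using r by (simp add: field_simps)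
  qed
  have h_cont: "continuous (at s within {0..}) ?h"
    using arrival_cont s by (simp add: continuous_on_eq_continuous_within)
  have "continuous (at s within {0..}) (A \<circ> ?h)"
    by (rule continuous_within_compose[OF h_cont continuous_within_subset[OF A_cont]])
      (use arrival(1) in auto)
  then have A_lim: "((\<lambda>r. A (?h r)) \<longlongrightarrow> a' (?h s)) (at s within {0..})"
    by (simp add: continuous_within A_s o_def)
  have B_lim: "(B \<longlongrightarrow> b' s) (at s within {0..})"
    using B_cont by (simp add: continuous_within B_s)
  have "continuous (at s within {0..}) (a \<circ> ?h)"
    by (rule continuous_within_compose[OF h_cont])
      (use arrival(1) s in \<open>auto intro!: continuous_within_subset[OF
          has_vector_derivative_continuous[OF a_deriv]]\<close>)
  moreover have "continuous (at s within {0..}) b"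
    using has_vector_derivative_continuous[OF b_deriv[OF s]] .
  ultimately have v_lim: "(?v \<longlongrightarrow> ?v s) (at s within {0..})"
    by (simp add: continuous_within o_def tendsto_diff)
  have "(n \<longlongrightarrow> (?v s + ?v s) /\<^sub>R (norm (?v s) + norm (?v s))) (at s within {0..})"
    unfolding n_def by (intro tendsto_intros v_lim) (use v_s in simp)
  moreover have "(?v s + ?v s) /\<^sub>R (norm (?v s) + norm (?v s)) = direction s"
    unfolding direction_def sgn_div_norm scaleR_2[symmetric] mult_2[symmetric] by simp
  ultimately have n_lim: "(n \<longlongrightarrow> direction s) (at s within {0..})"
    by simp
  have "((\<lambda>r. (c - n r \<bullet> B r) / (c - n r \<bullet> A (?h r))) \<longlongrightarrow> doppler s) (at s within {0..})"
    unfolding doppler_def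
    by (intro tendsto_intros n_lim A_lim B_lim) (use doppler_denominators(2)[OF s] in simp)
  then show ?thesis
    unfolding has_field_derivative_iff
    by (rule Lim_transform_within[where d = 1]) (use quotient in auto)
qed

text \<open>The uniqueness of the zero determines the arrival time pointwise, so the monotonicity and the
  smoothness in its characterisation are consequences of its being a zero.\<close>

lemma arrival_time_eq: "arrival_time c a b = restrict arrival {0..}"
  unfolding arrival_time_def
proof (rule the_equality)
  have "C1_halfline (restrict arrival {0..})"
    unfolding C1_halfline_def
  proof (intro exI conjI allI impI)
    fix t :: real assume "t \<ge> 0"
    then show "(restrict arrival {0..} has_vector_derivative doppler t) (at t within {0..})"
      using arrival_deriv[of t]
      by (auto simp flip: has_real_derivative_iff_has_vector_derivative
          elim!: has_field_derivative_transform_within[where d = 1])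
  qed (rule doppler_cont)
  then show "restrict arrival {0..} \<in> {0..} \<rightarrow>\<^sub>E {0..} \<and>
      strict_mono_on {0..} (restrict arrival {0..}) \<and> C1_halfline (restrict arrival {0..}) \<and>
      (\<forall>s\<ge>0. gap (restrict arrival {0..} s) s = 0)"
    using arrival arrival_strict_mono by (auto intro!: strict_mono_onI)
next
  fix h
  assume h: "h \<in> {0..} \<rightarrow>\<^sub>E {0..} \<and> strict_mono_on {0..} h \<and> C1_halfline h \<and>
    (\<forall>s\<ge>0. gap (h s) s = 0)"
  show "h = restrict arrival {0..}"
  proof
    fix s
    show "h s = restrict arrival {0..} s"
      using h arrival_eqI[of s "h s"] by (cases "s \<ge> 0") (auto simp: PiE_iff extensional_def)
  qed
qed

lemma first_arrival_eq: "first_arrival c a b = arrival 0"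
  unfolding first_arrival_def
  using arrival[of 0] arrival_later[of 0] by (intro the_equality) (auto dest: arrival_eqI[rotated 2])

definition emission :: "real \<Rightarrow> real" where
  "emission t = emission_time c b (a t) t"

text \<open>From the first arrival on, the travel-time function is nonnegative at emission time 0 and
  nonpositive at emission time \<open>t\<close>, and it decreases strictly in between.\<close>

lemma ex1_emission:
  assumes "t \<ge> arrival 0"
  shows "\<exists>!s. s \<ge> 0 \<and> gap t s = 0"
proof -
  have t: "t \<ge> 0"
    using assms arrival(1)[of 0] by simp
  have "gap t 0 \<ge> 0"
    using gap_receiver_strict[of "arrival 0" t 0] arrival[of 0] assms
    by (cases "t = arrival 0") auto
  moreover have "continuous_on {0..t} (\<lambda>s. gap t s)"
    unfolding g_def
    by (intro continuous_intros continuous_on_subset[OF b_cont]) (use c_pos in auto)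
  ultimately obtain s where "0 \<le> s" "gap t s = 0"
    using IVT2'[of "\<lambda>s. gap t s" t 0 0] gap_diag t by auto
  then show ?thesis
    using gap_source_strict by (metis linorder_cases order_less_irrefl)
qed

lemma emission:
  assumes "t \<ge> arrival 0"
  shows "emission t \<ge> 0" "gap t (emission t) = 0"
  using theI'[OF ex1_emission[OF assms]] unfolding emission_def emission_time_def g_def by auto

lemma arrival_emission: "t \<ge> arrival 0 \<Longrightarrow> arrival (emission t) = t"
  using emission[of t] arrival(1)[of 0] by (intro arrival_eqI) auto

lemma emission_arrival: "s \<ge> 0 \<Longrightarrow> emission (arrival s) = s"
  using ex1_emission[OF arrival_mono[of 0 s]] emission[OF arrival_mono[of 0 s]] arrival[of s]
  by auto

lemma inv_into_arrival_time:
  "t \<ge> arrival 0 \<Longrightarrow> inv_into {0..} (arrival_time c a b) t = emission t"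
  by (rule inv_into_f_eq)
    (auto simp: arrival_time_eq emission arrival_emission
      intro!: inj_on_inverseI[where g = emission] emission_arrival)

lemma distance_at_emission: "t \<ge> arrival 0 \<Longrightarrow> norm (a t - b (emission t)) = c * (t - emission t)"
  using emission gap_zero_iff by blast

lemma emission_mono: "s \<ge> 0 \<Longrightarrow> t \<ge> arrival s \<Longrightarrow> emission t \<ge> s"
  using arrival_strict_mono[of "emission t" s] arrival_mono[of 0 s]
  by (smt (verit) arrival_emission emission(1))

lemma emission_cont: "continuous_on {arrival 0..} emission"
proof (rule lipschitz_on_continuous_on)
  show "((c + c0) / (c - c0))-lipschitz_on {arrival 0..} emission"
  proof (rule lipschitz_onI)
    fix t1 t2 assume "t1 \<in> {arrival 0..}" "t2 \<in> {arrival 0..}"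
    then show "dist (emission t1) (emission t2) \<le> (c + c0) / (c - c0) * dist t1 t2"
      using arrival_expansive[of "emission t2" "emission t1"]
      by (simp add: emission arrival_emission dist_real_def)
  qed (use c0_less c0_nonneg in auto)
qed

lemma emission_deriv:
  assumes "s \<ge> 0"
  shows "(emission has_real_derivative 1 / doppler s) (at (arrival s) within {arrival 0..})"
proof (rule has_real_derivative_inverse_within[where f = arrival and S = "{0..}"])
  show "(arrival has_real_derivative doppler s) (at (emission (arrival s)) within {0..})"
    using arrival_deriv assms by (simp add: emission_arrival)
  show "continuous (at (arrival s) within {arrival 0..}) emission"
    using emission_cont arrival_mono[of 0 s] assms
    by (simp add: continuous_on_eq_continuous_within)
qed (use assms doppler_pos[of s] arrival_mono[of 0 s] in \<open>auto simp: emission arrival_emission\<close>)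

text \<open>For a subsonic source the Heaviside factor switches on exactly at the first arrival, and
  from then on the emission time inverts the arrival time.\<close>

lemma field_at_receiver:
  assumes "t \<ge> 0"
  shows "point_source_field c b f (a t) t =
    (if t \<ge> arrival 0 then f (emission t) / (4 * pi * norm (a t - b (emission t))) else 0)"
proof -
  have "0 \<le> gap t 0 \<longleftrightarrow> arrival 0 \<le> t"
    using gap_receiver_strict[of "arrival 0" t 0] gap_receiver_strict[of t "arrival 0" 0]
      arrival[of 0] assms by (cases t "arrival 0" rule: linorder_cases) auto
  then show ?thesis
    by (auto simp: point_source_field_def Let_def heaviside_def emission_def g_def)
qed

end

section \<open>The intensity of the scatterer\<close>

text \<open>Variation of constants.  The incident field is zero at the scatterer before the first arrival
  and may jump there, so at that time the intensity is differentiated from the right; on the half-line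
  after it the integrand is continuous, and the fundamental theorem of calculus applies.\<close>

lemma intensity_deriv:
  assumes path: "signal_path c c0 y z y' z'" and \<phi>: "continuous_on {0..} \<phi>"
    and t: "t \<ge> first_arrival c y z"
  shows "(intensity c \<alpha> y z \<phi> has_real_derivative
      4 * pi * c * (u_in c z \<phi> (y t) t - \<alpha> * intensity c \<alpha> y z \<phi> t))
    (at t within {first_arrival c y z..})"
proof -
  interpret signal_path c c0 y z y' z'
    by (rule path)
  let ?T = "arrival 0" and ?k = "4 * pi * c * \<alpha>" and ?q = "intensity c \<alpha> y z \<phi>"
  define G where "G r = \<phi> (emission r) / (4 * pi * norm (y r - z (emission r)))" for r
  have T: "?T > 0"
    using arrival_later[of 0] by simp
  have u: "u_in c z \<phi> (y r) r = (if r \<in> {?T..} then G r else 0)" if "r \<ge> 0" for r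
    using field_at_receiver[OF that] by (simp add: u_in_def G_def)
  have G_cont: "continuous_on {?T..} G"
  proof -
    have "continuous_on {?T..} (\<lambda>r. \<phi> (emission r))" "continuous_on {?T..} (\<lambda>r. z (emission r))"
      "continuous_on {?T..} y"
      using T emission(1)
      by (auto intro!: continuous_on_compose2[OF \<phi> emission_cont]
          continuous_on_compose2[OF b_cont emission_cont] continuous_on_subset[OF a_cont])
    then show ?thesis
      unfolding G_def
      by (intro continuous_intros) (use T apart emission(1) in auto)
  qed
  define I where "I s = integral {?T..s} (\<lambda>r. exp (?k * r) * G r)" for s
  have q: "?q s = 4 * pi * c * (exp (- (?k * s)) * I s)" if "s \<ge> ?T" for s
  proof -
    have "integral {0..s} (\<lambda>r. exp (- (?k * (s - r))) * u_in c z \<phi> (y r) r)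
        = integral {0..s} (\<lambda>r. exp (- (?k * s)) *
            (if r \<in> {?T..} then exp (?k * r) * G r else 0))"
      by (rule integral_cong) (auto simp: u right_diff_distrib simp flip: exp_add)
    also have "\<dots> = exp (- (?k * s)) * integral ({?T..} \<inter> {0..s}) (\<lambda>r. exp (?k * r) * G r)"
      by (simp only: integral_mult_right integral_restrict_Int Int_commute)
    also have "{?T..} \<inter> {0..s} = {?T..s}"
      using T by auto
    finally show ?thesis
      by (simp add: intensity_def I_def)
  qed
  have t': "t \<ge> ?T"
    using t by (simp add: first_arrival_eq)
  \<comment> \<open>The right end \<open>t + 1\<close> only serves to make the interval compact with \<open>t\<close> not at its right end.\<close>
  have "(I has_real_derivative exp (?k * t) * G t) (at t within {?T..t + 1})"
    unfolding I_def
    by (rule integral_has_real_derivative)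
      (use t' in \<open>auto intro!: continuous_intros continuous_on_subset[OF G_cont]\<close>)
  moreover have "at t within {?T..t + 1} = at t within {?T..}"
    by (rule at_within_nhd[where S = "{..<t + 1}"]) auto
  ultimately have I: "(I has_real_derivative exp (?k * t) * G t) (at t within {?T..})"
    by simp
  have "((\<lambda>s. 4 * pi * c * (exp (- (?k * s)) * I s)) has_real_derivative
      4 * pi * c * (exp (- (?k * t)) * (exp (?k * t) * G t) - ?k * (exp (- (?k * t)) * I t)))
      (at t within {?T..})"
    by (auto intro!: derivative_eq_intros I simp: algebra_simps)
  moreover have "exp (- (?k * t)) * (exp (?k * t) * G t) = u_in c z \<phi> (y t) t"
    using T t' by (simp add: u flip: mult.assoc exp_add)
  moreover have "?k * (exp (- (?k * t)) * I t) = \<alpha> * ?q t"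
    using q[OF t'] by simp
  ultimately have "((\<lambda>s. 4 * pi * c * (exp (- (?k * s)) * I s)) has_real_derivative
      4 * pi * c * (u_in c z \<phi> (y t) t - \<alpha> * ?q t)) (at t within {?T..})"
    by (simp only:)
  then have "(?q has_real_derivative 4 * pi * c * (u_in c z \<phi> (y t) t - \<alpha> * ?q t)) (at t within {?T..})"
    by (rule has_field_derivative_transform_within[where d = 1]) (use t' q in auto)
  then show ?thesis
    by (simp add: first_arrival_eq)
qed

section \<open>The differential equation for the distance\<close>

text \<open>Here \<open>h\<close> is the derivative of the arrival time and \<open>w\<close> the incident field at the scatterer.
  The distance \<open>d\<close>, as a function of the receiving time, has the derivative \<open>c (1 - 1/h)\<close>, so
  \<open>U'\<close> is the quotient rule for \<open>q / (4 \<pi> d)\<close> in that time.  The product form makes sense also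
  when the denominator of the differential equation vanishes.\<close>

lemma distance_equation_algebra:
  fixes c d q q' \<alpha> w h :: real
  assumes "c > 0" "d > 0" "h > 0"
    and q': "q' = 4 * pi * c * (w - \<alpha> * q)"
  defines "U \<equiv> q / (4 * pi * d)"
    and "U' \<equiv> (q' / h * d - q * (c * (1 - 1 / h))) / (d * d) / (4 * pi)"
  shows "c * w + (c - 4 * pi * c * \<alpha> * d) * U = c * h * (U + d / c * U')"
  using assms(1-3) unfolding U_def U'_def q' by (simp add: field_simps power2_eq_square)

theorem theorem4p4:
  fixes c \<alpha> c0 T :: real
    and \<phi> :: "real \<Rightarrow> real"
    and z y :: trajectory
    and x :: "4 \<Rightarrow> trajectory"
    and i :: 4
    and \<Omega>1 \<Omega>2 :: "(real^3) set"
  assumes "c > 0" and "\<alpha> > 0"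
    and "C1_halfline \<phi>" and "\<forall>t\<ge>0. \<phi> t > 0"
    and "C1_halfline z" and "C1_halfline y" and "\<forall>j. C1_halfline (x j)"
    and "0 < c0" and "c0 < c"
    and "\<forall>t>0. norm (vector_derivative z (at t)) < c0"
    and "\<forall>t>0. norm (vector_derivative y (at t)) < c0"
    and "\<forall>j. \<forall>t>0. norm (vector_derivative (x j) (at t)) < c0"
    and "smooth_bounded_domain \<Omega>1" and "smooth_bounded_domain \<Omega>2" and "\<Omega>1 \<subseteq> \<Omega>2"
    and "\<forall>t\<ge>0. y t \<in> \<Omega>1"
    and "\<forall>t\<ge>0. z t \<notin> closure \<Omega>2"
    and "\<forall>j. \<forall>t\<ge>0. x j t \<notin> closure \<Omega>2"
    and "T > 0"
    and "\<forall>j. z ` {0<..<T} \<inter> x j ` {0<..<T} = {}"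
    and "\<forall>j k. j \<noteq> k \<longrightarrow> x j ` {0<..<T} \<inter> x k ` {0<..<T} = {}"
    and "\<forall>t :: 4 \<Rightarrow> real. (\<forall>j. t j > 0) \<longrightarrow> \<not> coplanar (range (\<lambda>j. x j (t j)))"
  defines "h\<^sub>z \<equiv> arrival_time c y z"
    and "h\<^sub>x \<equiv> arrival_time c (x i) y"
    and "T0 \<equiv> first_arrival c y z"
  defines "d\<^sub>x \<equiv> \<lambda>t. norm (x i (h\<^sub>x t) - y t)"
    and "d\<^sub>z \<equiv> \<lambda>t. norm (y t - z (inv_into {0..} h\<^sub>z t))"
    and "U \<equiv> \<lambda>t. u_sc c \<alpha> y z \<phi> (x i t) t"
  shows "\<forall>t\<ge>T0. \<exists>D U'.
      (d\<^sub>x has_real_derivative D) (at t within {T0..}) \<and>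
      (U has_real_derivative U') (at (d\<^sub>x t / c + t) within {h\<^sub>x T0..}) \<and>
      (let num = c * \<phi> (t - d\<^sub>z t / c) / (4 * pi * d\<^sub>z t)
                 + (c - 4 * pi * c * \<alpha> * d\<^sub>x t) * U (d\<^sub>x t / c + t);
           den = U (d\<^sub>x t / c + t) + d\<^sub>x t / c * U'
       in (den \<noteq> 0 \<longrightarrow> D = num / den - c) \<and> (den = 0 \<longrightarrow> num = 0))"
proof (intro allI impI)
  fix t assume t: "t \<ge> T0"
  obtain y' where y': "\<And>t. t \<ge> 0 \<Longrightarrow> (y has_vector_derivative y' t) (at t within {0..})"
    "continuous_on {0..} y'" "\<And>t. t \<ge> 0 \<Longrightarrow> norm (y' t) \<le> c0"
    using subsonic_derivative assms(6,11) by blast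
  obtain z' where z': "\<And>t. t \<ge> 0 \<Longrightarrow> (z has_vector_derivative z' t) (at t within {0..})"
    "continuous_on {0..} z'" "\<And>t. t \<ge> 0 \<Longrightarrow> norm (z' t) \<le> c0"
    using subsonic_derivative assms(5,10) by blast
  obtain x' where x': "\<And>t. t \<ge> 0 \<Longrightarrow> (x i has_vector_derivative x' t) (at t within {0..})"
    "continuous_on {0..} x'" "\<And>t. t \<ge> 0 \<Longrightarrow> norm (x' t) \<le> c0"
    using subsonic_derivative[of "x i" c0] assms(7,12) by blast
  \<comment> \<open>The domains keep the scatterer apart from the emitter and from the receiver.\<close>
  have y_in: "y s \<in> closure \<Omega>2" if "s \<ge> 0" for s
    using assms(15,16) that closure_subset by blast
  interpret Z: signal_path c c0 y z y' z'
    by unfold_locales (use assms(8,9,17) y' z' y_in in \<open>auto, metis\<close>)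
  interpret X: signal_path c c0 "x i" y x' y'
    by unfold_locales (use assms(8,9,18) x' y' y_in in \<open>auto, metis\<close>)
  let ?q = "intensity c \<alpha> y z \<phi>" and ?h = X.arrival
  have T0: "T0 = Z.arrival 0"
    by (simp add: T0_def Z.first_arrival_eq)
  have T0_pos: "T0 > 0"
    using Z.arrival_later[of 0] by (simp add: T0)
  then have t0: "t \<ge> 0"
    using t by simp
  have hx: "h\<^sub>x s = ?h s" if "s \<ge> 0" for s
    using that by (simp add: h\<^sub>x_def X.arrival_time_eq)
  have dx: "d\<^sub>x s = c * (?h s - s)" if "s \<ge> 0" for s
    using that by (simp add: d\<^sub>x_def hx X.distance_at_arrival)
  have dz: "d\<^sub>z t = norm (y t - z (Z.emission t))" "t - d\<^sub>z t / c = Z.emission t"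
    using t Z.distance_at_emission[of t] assms(1)
    by (simp_all add: d\<^sub>z_def h\<^sub>z_def T0 Z.inv_into_arrival_time)
  have \<tau>: "d\<^sub>x t / c + t = ?h t"
    using dx[OF t0] assms(1) by simp
  have U: "U r = ?q (X.emission r) / (c * (r - X.emission r)) / (4 * pi)" if "r \<ge> ?h 0" for r
    using that X.arrival(1)[of 0] X.field_at_receiver[of r] X.distance_at_emission[of r]
    by (simp add: U_def u_sc_def)

  define w where "w = u_in c z \<phi> (y t) t"
  define q' where "q' = 4 * pi * c * (w - \<alpha> * ?q t)"
  have w: "w = \<phi> (t - d\<^sub>z t / c) / (4 * pi * d\<^sub>z t)"
    using Z.field_at_receiver[OF t0] t unfolding dz(2) by (simp add: w_def u_in_def dz(1) T0)
  have "continuous_on {0..} \<phi>"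
    using assms(3) unfolding C1_halfline_def
    by (auto simp: continuous_on_eq_continuous_within intro: has_vector_derivative_continuous)
  then have q: "(?q has_real_derivative q') (at t within {T0..})"
    using intensity_deriv[OF Z.signal_path_axioms, of \<phi> t \<alpha>] t by (simp add: q'_def w_def T0_def)

  have arrival: "(?h has_real_derivative X.doppler t) (at t within {T0..})"
    using X.arrival_deriv[OF t0] by (rule has_field_derivative_subset) (use T0_pos in auto)
  have "((\<lambda>s. c * (?h s - s)) has_real_derivative c * (X.doppler t - 1)) (at t within {T0..})"
    by (auto intro!: derivative_eq_intros arrival)
  then have D: "(d\<^sub>x has_real_derivative c * (X.doppler t - 1)) (at t within {T0..})"
    by (rule has_field_derivative_transform_within[where d = 1]) (use t T0_pos dx in auto)

  have late: "?h 0 \<le> ?h T0" "?h T0 \<le> ?h t"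
    using T0_pos t by (auto intro!: X.arrival_mono)
  have emission: "(X.emission has_real_derivative 1 / X.doppler t) (at (?h t) within {?h T0..})"
    using X.emission_deriv[OF t0] by (rule has_field_derivative_subset) (use late in auto)
  have "(?q has_real_derivative q') (at (X.emission (?h t)) within X.emission ` {?h T0..})"
    using q T0_pos t0 X.emission_mono[of T0]
    by (auto simp: X.emission_arrival intro!: has_field_derivative_subset[OF q])
  from DERIV_image_chain[OF this emission]
  have qe: "((\<lambda>r. ?q (X.emission r)) has_real_derivative q' / X.doppler t) (at (?h t) within {?h T0..})"
    by (simp add: o_def)
  define U' where "U' = (q' / X.doppler t * d\<^sub>x t - ?q t * (c * (1 - 1 / X.doppler t))) / (d\<^sub>x t * d\<^sub>x t) / (4 * pi)"
  have dx_pos: "d\<^sub>x t > 0"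
    using X.arrival_later[OF t0] assms(1) by (simp add: dx[OF t0])
  have "((\<lambda>r. c * (r - X.emission r)) has_real_derivative c * (1 - 1 / X.doppler t))
      (at (?h t) within {?h T0..})"
    by (auto intro!: derivative_eq_intros emission)
  from DERIV_divide[OF qe this]
  have "((\<lambda>r. ?q (X.emission r) / (c * (r - X.emission r)) / (4 * pi)) has_real_derivative U')
      (at (?h t) within {?h T0..})"
    using X.arrival_later[OF t0] assms(1) unfolding U'_def
    by (intro DERIV_cdivide) (simp add: X.emission_arrival[OF t0] dx[OF t0] less_imp_neq[symmetric])
  then have U'_deriv: "(U has_real_derivative U') (at (d\<^sub>x t / c + t) within {h\<^sub>x T0..})"
    unfolding \<tau> hx[OF less_imp_le[OF T0_pos]]
    by (rule has_field_derivative_transform_within[where d = 1]) (use late U in auto)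

  have U_t: "U (d\<^sub>x t / c + t) = ?q t / (4 * pi * d\<^sub>x t)"
    unfolding \<tau> using U[of "?h t"] late by (simp add: X.emission_arrival[OF t0] dx[OF t0])
  have "c * \<phi> (t - d\<^sub>z t / c) / (4 * pi * d\<^sub>z t)
        + (c - 4 * pi * c * \<alpha> * d\<^sub>x t) * U (d\<^sub>x t / c + t)
      = c * X.doppler t * (U (d\<^sub>x t / c + t) + d\<^sub>x t / c * U')"
    using distance_equation_algebra[OF assms(1) dx_pos X.doppler_pos[OF t0] q'_def]
    unfolding U_t U'_def w by simp
  then have "let num = c * \<phi> (t - d\<^sub>z t / c) / (4 * pi * d\<^sub>z t)
                 + (c - 4 * pi * c * \<alpha> * d\<^sub>x t) * U (d\<^sub>x t / c + t);
           den = U (d\<^sub>x t / c + t) + d\<^sub>x t / c * U'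
       in (den \<noteq> 0 \<longrightarrow> c * (X.doppler t - 1) = num / den - c) \<and> (den = 0 \<longrightarrow> num = 0)"
    by (simp add: Let_def right_diff_distrib)
  with D U'_deriv show "\<exists>D U'.
      (d\<^sub>x has_real_derivative D) (at t within {T0..}) \<and>
      (U has_real_derivative U') (at (d\<^sub>x t / c + t) within {h\<^sub>x T0..}) \<and>
      (let num = c * \<phi> (t - d\<^sub>z t / c) / (4 * pi * d\<^sub>z t)
                 + (c - 4 * pi * c * \<alpha> * d\<^sub>x t) * U (d\<^sub>x t / c + t);
           den = U (d\<^sub>x t / c + t) + d\<^sub>x t / c * U'
       in (den \<noteq> 0 \<longrightarrow> D = num / den - c) \<and> (den = 0 \<longrightarrow> num = 0))"
    by blast
qed

end
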